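(* Let $m\ge 1$ and let $k_1,\ldots,k_m$ be positive integers. Let $K(r)$ be the fibered two-bridge knot (or two-component two-bridge link) with $$r=[\,\underbrace{2,\ldots,2}_{k_1},\underbrace{-2,\ldots,-2}_{k_2},\ldots,\underbrace{(-1)^{m-1}2,\ldots,(-1)^{m-1}2}_{k_m}\,].$$ If $k_j\in\{1,2\}$ for all $j=1,\ldots,m$, then every zero $\alpha\in\mathbb{C}$ of the Alexander polynomial $\Delta_{K(r)}(t)$ satisfies $\operatorname{Re}(\alpha)>-1$.
   Context: For nonzero integers $a_1,\ldots,a_n$, the notation $[2a_1,\ldots,2a_n]$ denotes the even negative continued fraction $$[2a_1,2a_2,\ldots,2a_n]:=\cfrac{1}{2a_1-\cfrac{1}{2a_2-\cfrac{1}{\ddots-\cfrac{1}{2a_n}}}}.$$ $K(r)$ denotes the two-bridge knot ($n$ even) or two-component two-bridge link ($n$ odd) identified by the rational number $r=[2a_1,\ldots,2a_n]$; it is known that $K(r)$ is fibered if and only if $|a_j|=1$ for all $j$. The expansion gives a diagram of $K(r)$ and a minimal genus Seifert surface whose Seifert matrix is the $n\times n$ matrix $U=(u_{ij})$ with $u_{ii}=a_i$ for all $i$; $u_{i,i-1}=-1$ for every even $i$ with $2\le i\le n$; $u_{i,i+1}=1$ for every even $i$ with $i+1\le n$; and all other entries $0$. The Alexander polynomial is $\Delta_{K(r)}(t)=\det(tU-U^T)$ with this $U$. In the claim, $n=k_1+\cdots+k_m$ and the sequence $(a_1,\ldots,a_n)$ consists of $k_1$ entries equal to $1$, followed by $k_2$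 entries equal to $-1$, and so on with alternating signs. *)

theory Defs
  imports Complex_Main "Jordan_Normal_Form.Determinant"
begin

text \<open>The negative continued fraction of an arbitrary list of integer entries. The empty
  fraction is 0, so that the innermost level of a nonempty fraction is \<open>1 / c\<^sub>n\<close>. If all entries
  are nonzero and even, no denominator vanishes (see \<open>neg_cf_even_bound\<close>).\<close>

fun neg_cf :: "int list \<Rightarrow> rat" where
  "neg_cf [] = 0"
| "neg_cf (c # cs) = 1 / (of_int c - neg_cf cs)"

text \<open>The list \<open>as\<close> is an even expansion of \<open>r\<close> if \<open>r = [2a\<^sub>1, \<dots>, 2a\<^sub>n]\<close> with \<open>n \<ge> 1\<close> and all
  \<open>a\<^sub>i\<close> nonzero.\<close>

definition even_expansion :: "rat \<Rightarrow> int list \<Rightarrow> bool" where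
  "even_expansion r as \<longleftrightarrow> as \<noteq> [] \<and> 0 \<notin> set as \<and> r = neg_cf (map (\<lambda>a. 2 * a) as)"

text \<open>Entry \<open>u\<^sub>i\<^sub>j\<close> of the Seifert matrix, with 1-based indices; the matrix type is 0-based,
  hence the shift in \<open>seifert_matrix\<close>.\<close>

definition seifert_entry :: "int list \<Rightarrow> nat \<Rightarrow> nat \<Rightarrow> int" where
  "seifert_entry as i j =
     (if i = j then as ! (i - 1)
      else if even i \<and> i = j + 1 then -1
      else if even i \<and> j = i + 1 then 1
      else 0)"

definition seifert_matrix :: "int list \<Rightarrow> int mat" where
  "seifert_matrix as =
     mat (length as) (length as) (\<lambda>(i, j). seifert_entry as (i + 1) (j + 1))"

text \<open>\<open>det (t U - U\<^sup>T)\<close> as a polynomial in \<open>t\<close>.\<close>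

definition seifert_poly :: "int mat \<Rightarrow> int poly" where
  "seifert_poly U =
     det ([:0, 1:] \<cdot>\<^sub>m map_mat (\<lambda>u. [:u:]) U - map_mat (\<lambda>u. [:u:]) (transpose_mat U))"

text \<open>The Alexander polynomial of the two-bridge knot or link \<open>K(r)\<close>, given by the Seifert matrix
  of the minimal genus Seifert surface that belongs to the even expansion of \<open>r\<close>. The expansion
  is unique (\<open>even_expansion_unique\<close>), so the description is proper whenever \<open>r\<close> has one
  (\<open>two_bridge_alexander_eq\<close>).\<close>

definition two_bridge_alexander :: "rat \<Rightarrow> int poly" where
  "two_bridge_alexander r =
     (THE p. \<exists>as. even_expansion r as \<and> p = seifert_poly (seifert_matrix as))"

lemma neg_cf_even_bound:
  assumes "0 \<notin> set as"
  shows "\<bar>neg_cf (map (\<lambda>a. 2 * a) as)\<bar> < 1"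
  using assms
proof (induction as)
  case Nil
  then show ?case by simp
next
  case (Cons a as)
  let ?x = "neg_cf (map (\<lambda>a. 2 * a) as)"
  have x: "\<bar>?x\<bar> < 1" using Cons by simp
  have "\<bar>a\<bar> \<ge> 1" using Cons.prems by auto
  then have "\<bar>of_int a :: rat\<bar> \<ge> 1" by (metis of_int_1_le_iff of_int_abs)
  then have "\<bar>2 * of_int a - ?x\<bar> > 1" using x by linarith
  then show ?case by (simp add: divide_simps)
qed

lemma neg_cf_even_nonzero:
  assumes "0 \<notin> set as" and "as \<noteq> []"
  shows "neg_cf (map (\<lambda>a. 2 * a) as) \<noteq> 0"
proof (cases as)
  case Nil
  then show ?thesis using assms by simp
next
  case (Cons a bs)
  let ?x = "neg_cf (map (\<lambda>a. 2 * a) bs)"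
  have x: "\<bar>?x\<bar> < 1" using neg_cf_even_bound[of bs] assms Cons by simp
  have "\<bar>a\<bar> \<ge> 1" using assms Cons by auto
  then have "\<bar>of_int a :: rat\<bar> \<ge> 1" by (metis of_int_1_le_iff of_int_abs)
  then have "2 * of_int a - ?x \<noteq> 0" using x by linarith
  then show ?thesis by (simp add: Cons)
qed

lemma neg_cf_even_inj:
  assumes "0 \<notin> set as" and "0 \<notin> set bs"
    and "neg_cf (map (\<lambda>a. 2 * a) as) = neg_cf (map (\<lambda>a. 2 * a) bs)"
  shows "as = bs"
  using assms
proof (induction as arbitrary: bs)
  case Nil
  then show ?case using neg_cf_even_nonzero[of bs] by auto
next
  case (Cons a as)
  then have "bs \<noteq> []" using neg_cf_even_nonzero[of "a # as"] by auto
  then obtain b bs' where bs: "bs = b # bs'" by (cases bs) auto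
  let ?x = "neg_cf (map (\<lambda>a. 2 * a) as)" and ?y = "neg_cf (map (\<lambda>a. 2 * a) bs')"
  have eq: "2 * of_int a - ?x = 2 * of_int b - ?y"
    using Cons.prems(3) by (simp add: bs)
  have "\<bar>?x\<bar> < 1" "\<bar>?y\<bar> < 1"
    using neg_cf_even_bound[of as] neg_cf_even_bound[of bs'] Cons.prems bs by auto
  then have "\<bar>of_int (a - b) :: rat\<bar> < 1" using eq by simp
  then have "\<bar>a - b\<bar> < 1" by (metis of_int_abs of_int_less_1_iff)
  then have "a = b" by simp
  then show ?case using eq Cons bs by auto
qed

lemma even_expansion_unique:
  "even_expansion r as \<Longrightarrow> even_expansion r bs \<Longrightarrow> as = bs"
  unfolding even_expansion_def using neg_cf_even_inj by blast

lemma two_bridge_alexander_eq: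
  assumes "even_expansion r as"
  shows "two_bridge_alexander r = seifert_poly (seifert_matrix as)"
  unfolding two_bridge_alexander_def
  using assms even_expansion_unique by blast

end

theory Submission imports Defs "Jordan_Normal_Form.Char_Poly" begin

text \<open>A zero \<open>t\<close> of the Alexander polynomial gives a kernel vector of the tridiagonal matrix
  \<open>t U - U\<^sup>T\<close>. Write \<open>t = x\<^sup>2\<close> and divide every second coordinate by \<open>x\<close>: the coordinates \<open>y\<^sub>i\<close>
  then satisfy \<open>y\<^sub>i\<^sub>+\<^sub>1 = y\<^sub>i\<^sub>-\<^sub>1 - a\<^sub>i z y\<^sub>i\<close> with \<open>z = x - 1/x\<close>, so \<open>q\<^sub>i = - a\<^sub>i y\<^sub>i\<^sub>+\<^sub>1 / y\<^sub>i\<close> satisfies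
  \<open>q\<^sub>1 = z\<close> and \<open>q\<^sub>i = z + a\<^sub>i a\<^sub>i\<^sub>-\<^sub>1 / q\<^sub>i\<^sub>-\<^sub>1\<close>. If \<open>Re t \<le> -1\<close>, then \<open>x\<close> can be chosen with \<open>Im x \<ge> 1\<close>, and
  hence \<open>Im z > 1\<close>. A sign change \<open>q \<mapsto> z - 1/q\<close> sends \<open>Im q > 0\<close> to \<open>Im q \<ge> Im z\<close>, and a repeated
  sign \<open>q \<mapsto> z + 1/q\<close> sends \<open>Im q \<ge> Im z\<close> back to \<open>Im q > 0\<close>. As no sign occurs three times in a
  row, all \<open>q\<^sub>i\<close> have positive imaginary part, which contradicts \<open>y\<^sub>n\<^sub>+\<^sub>1 = 0\<close>.\<close>

section \<open>Imaginary parts of reciprocals\<close>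

lemma Im_inverse_ge:
  assumes "Im q \<ge> h" "h > 0"
  shows "Im (1 / q) \<ge> - (1 / h)"
proof -
  have pos: "(Re q)\<^sup>2 + (Im q)\<^sup>2 > 0"
    using assms by (smt (verit) zero_le_power2 zero_less_power)
  \<comment> \<open>Since \<open>Im (1 / q)\<close> is \<open>- Im q\<close> over the squared
    modulus of \<open>q\<close>, it suffices to bound \<open>h * Im q\<close> by that squared
    modulus.\<close>
  have "h * Im q \<le> (Im q)\<^sup>2"
    using assms by (simp add: power2_eq_square mult_right_mono)
  then have "h * Im q \<le> (Re q)\<^sup>2 + (Im q)\<^sup>2"
    by (smt (verit) zero_le_power2)
  then have "Im q / ((Re q)\<^sup>2 + (Im q)\<^sup>2) \<le> 1 / h"
    using pos assms by (simp add: field_simps)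
  then show ?thesis by (simp add: Im_divide)
qed

lemma Im_inverse_neg:
  assumes "Im q > 0"
  shows "Im (1 / q) < 0"
proof -
  have "(Re q)\<^sup>2 + (Im q)\<^sup>2 > 0"
    using assms by (smt (verit) zero_le_power2 zero_less_power)
  then show ?thesis using assms by (simp add: Im_divide)
qed

section \<open>Sign sequences made of blocks of length one or two\<close>

definition no_three_equal :: "'a list \<Rightarrow> bool" where
  "no_three_equal xs \<longleftrightarrow>
     (\<forall>i. i + 2 < length xs \<longrightarrow> \<not> (xs ! i = xs ! (i + 1) \<and> xs ! (i + 1) = xs ! (i + 2)))"

lemma no_three_equal_append:
  assumes "no_three_equal xs" "xs \<noteq> [] \<Longrightarrow> last xs \<noteq> b" "k \<in> {1, 2}"
  shows "no_three_equal (xs @ replicate k b)"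
  unfolding no_three_equal_def
proof (intro allI impI)
  fix i assume i: "i + 2 < length (xs @ replicate k b)"
  let ?l = "xs @ replicate k b"
  show "\<not> (?l ! i = ?l ! (i + 1) \<and> ?l ! (i + 1) = ?l ! (i + 2))"
  proof (cases "i + 2 < length xs")
    case True
    then show ?thesis using assms(1) by (auto simp: no_three_equal_def nth_append)
  next
    case False
    \<comment> \<open>The window ends in the new block. As \<open>k \<le> 2\<close>, it also
      contains the last entry of \<open>xs\<close>, which differs from \<open>b\<close>.\<close>
    have len: "length xs > 0" using i assms(3) False by auto
    then have last: "?l ! (length xs - 1) \<noteq> b"
      using assms(2) by (simp add: nth_append last_conv_nth)
    have b: "?l ! (i + 2) = b"
      using i False by (auto simp: nth_append)
    have "length xs - 1 = i \<or> length xs - 1 = i + 1"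
      using i False assms(3) len by auto
    then show ?thesis using last b by auto
  qed
qed

text \<open>The last entry is carried through the induction because the next block can be appended
  only if its sign differs from it.\<close>

lemma sign_blocks:
  fixes k :: "nat \<Rightarrow> nat"
  assumes "\<And>j. j \<in> {1..m} \<Longrightarrow> k j \<in> {1, 2}"
  defines "xs \<equiv> concat (map (\<lambda>j. replicate (k j) ((-1 :: int) ^ (j - 1))) [1..<m + 1])"
  shows "no_three_equal xs \<and> set xs \<subseteq> {1, -1} \<and> (m \<ge> 1 \<longrightarrow> xs \<noteq> [] \<and> last xs = (-1) ^ (m - 1))"
  using assms(1) unfolding xs_def
proof (induction m)
  case 0
  then show ?case by (simp add: no_three_equal_def)
next
  case (Suc m)
  let ?xs = "concat (map (\<lambda>j. replicate (k j) ((-1 :: int) ^ (j - 1))) [1..<m + 1])"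
  have "no_three_equal ?xs \<and> set ?xs \<subseteq> {1, -1}
      \<and> (m \<ge> 1 \<longrightarrow> ?xs \<noteq> [] \<and> last ?xs = (-1) ^ (m - 1))"
    by (rule Suc.IH) (use Suc.prems in simp)
  then have IH: "no_three_equal ?xs" "set ?xs \<subseteq> {1, -1}"
      "m \<ge> 1 \<Longrightarrow> ?xs \<noteq> [] \<and> last ?xs = (-1) ^ (m - 1)"
    by blast+
  have k: "k (Suc m) \<in> {1, 2}" using Suc.prems by simp
  have eq: "concat (map (\<lambda>j. replicate (k j) ((-1 :: int) ^ (j - 1))) [1..<Suc m + 1])
      = ?xs @ replicate (k (Suc m)) ((-1) ^ m)"
    by simp
  have "last ?xs \<noteq> (-1) ^ m" if "?xs \<noteq> []"
  proof -
    have m: "m \<ge> 1" using that by (cases m) auto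
    then have "(-1 :: int) ^ m = - ((-1) ^ (m - 1))" by (cases m) auto
    moreover have "(-1 :: int) ^ (m - 1) \<noteq> - ((-1) ^ (m - 1))" by simp
    ultimately show ?thesis using IH(3)[OF m] by metis
  qed
  then have "no_three_equal (?xs @ replicate (k (Suc m)) ((-1) ^ m))"
    by (intro no_three_equal_append IH k)
  moreover have "(-1 :: int) ^ m \<in> {1, -1}" by (cases "even m") auto
  moreover have "k (Suc m) \<noteq> 0" using k by auto
  ultimately show ?case unfolding eq using IH(2) by auto
qed

section \<open>The three-term recurrence with zero boundary values\<close>

lemma continuant_solution_zero:
  fixes y a :: "nat \<Rightarrow> complex" and z :: complex
  assumes z: "Im z > 1"
    and a: "\<And>i. i \<in> {1..n} \<Longrightarrow> a i \<in> {1, -1}"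
    and no3: "\<And>i. \<lbrakk>1 \<le> i; i + 2 \<le> n; a i = a (i + 1)\<rbrakk> \<Longrightarrow> a (i + 1) \<noteq> a (i + 2)"
    and y0: "y 0 = 0"
    and rec: "\<And>i. i < n \<Longrightarrow> y (i + 2) = y i - a (i + 1) * z * y (i + 1)"
    and yn: "y (n + 1) = 0"
  shows "\<forall>i \<le> n. y i = 0"
proof (cases "y 1 = 0")
  case True
  \<comment> \<open>Two consecutive zeros propagate through the recurrence.\<close>
  have "i \<le> n \<longrightarrow> y i = 0 \<and> y (i + 1) = 0" for i
    by (induction i) (use y0 True rec in auto)
  then show ?thesis by blast
next
  case False
  define q where "q i = - a i * y (i + 1) / y i" for i
  \<comment> \<open>The stronger bound holds at the start of each run of equal signs; it is what
    keeps \<open>Im q\<close> positive at the second entry of the run.\<close>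
  have inv: "y i \<noteq> 0 \<and> Im (q i) > 0 \<and> (i = 1 \<or> a i \<noteq> a (i - 1) \<longrightarrow> Im (q i) \<ge> Im z)"
    if "1 \<le> i" "i \<le> n" for i
    using that
  proof (induction i rule: nat_induct_at_least)
    case base
    have "a 1 * a 1 = 1" using a[of 1] base by auto
    then have "q 1 = z"
      using rec[of 0] base y0 False
      by (simp add: q_def numeral_2_eq_2 mult.assoc[symmetric])
    then show ?case using False z by simp
  next
    case (Suc i)
    have IH: "y i \<noteq> 0" "Im (q i) > 0" "i = 1 \<or> a i \<noteq> a (i - 1) \<Longrightarrow> Im (q i) \<ge> Im z"
      using Suc by auto
    have ai: "a i \<in> {1, -1}" and as: "a (Suc i) \<in> {1, -1}"
      using a[of i] a[of "Suc i"] Suc by auto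
    have "q i \<noteq> 0" using IH(2) by auto
    then have ys: "y (Suc i) \<noteq> 0" by (auto simp: q_def)
    \<comment> \<open>The coefficient of \<open>z\<close> is the square of a sign, hence 1.\<close>
    have "q (Suc i) = z - a (Suc i) * y i / y (Suc i)"
      using rec[of i] Suc ys as by (auto simp: q_def field_simps)
    also have "y i / y (Suc i) = - a i / q i"
      using ai ys IH(1) by (auto simp: q_def field_simps)
    then have "z - a (Suc i) * y i / y (Suc i) = z + a (Suc i) * a i * (1 / q i)"
      by (simp only: times_divide_eq_right[symmetric]) simp
    finally have q: "q (Suc i) = z + a (Suc i) * a i * (1 / q i)" .
    show ?case
    proof (cases "a (Suc i) = a i")
      case True
      then have "q (Suc i) = z + 1 / q i" using q ai by auto
      \<comment> \<open>A run has at most two entries, so \<open>i\<close> starts the run that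
        \<open>Suc i\<close> continues, and the stronger bound is available.\<close>
      moreover have "i = 1 \<or> a i \<noteq> a (i - 1)"
        using no3[of "i - 1"] Suc.hyps Suc.prems True by (cases "i = 1") force+
      then have "Im (1 / q i) \<ge> - (1 / Im z)"
        using Im_inverse_ge[OF IH(3)] z by linarith
      moreover have "1 / Im z < Im z"
        using z by (smt (verit) divide_less_eq_1_pos)
      ultimately show ?thesis using True ys Suc by auto
    next
      case False
      then have "a (Suc i) * a i = -1" using ai as by auto
      then have "q (Suc i) = z - 1 / q i" using q by simp
      moreover have "Im (1 / q i) < 0" by (rule Im_inverse_neg[OF IH(2)])
      ultimately show ?thesis using ys z by simp
    qed
  qed
  \<comment> \<open>For \<open>n = 0\<close> the two assumptions on \<open>y 1\<close> clash;
    otherwise \<open>y (n + 1) = 0\<close> forces \<open>q n = 0\<close>.\<close>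
  have "n \<ge> 1" using False yn by (cases n) auto
  then have "Im (q n) > 0" using inv by blast
  then show ?thesis using yn by (simp add: q_def)
qed

section \<open>From a zero of the Alexander polynomial to the recurrence\<close>

lemma sqrt_with_Im_ge_1:
  assumes "Re t \<le> -1"
  obtains x where "x\<^sup>2 = t" "Im x \<ge> 1"
proof -
  have "(Re (csqrt t))\<^sup>2 - (Im (csqrt t))\<^sup>2 \<le> -1"
    using assms by (metis Re_power2 power2_csqrt)
  then have "1\<^sup>2 \<le> (Im (csqrt t))\<^sup>2"
    by (smt (verit) one_power2 zero_le_power2)
  then have "1 \<le> \<bar>Im (csqrt t)\<bar>"
    using abs_le_square_iff[of 1 "Im (csqrt t)"] by simp
  \<comment> \<open>Of the two square roots, take the one in the upper half-plane.\<close>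
  then show thesis
    using that[of "csqrt t"] that[of "- csqrt t"] by (cases "Im (csqrt t) \<ge> 0") auto
qed

lemma seifert_kernel_vector:
  assumes "poly (map_poly of_int (seifert_poly (seifert_matrix as))) \<alpha> = (0 :: complex)"
  obtains w :: "nat \<Rightarrow> complex"
  where "w 0 = 0" "w (length as + 1) = 0" "\<exists>i \<in> {1..length as}. w i \<noteq> 0"
    and "\<And>i. i < length as \<Longrightarrow> even i \<Longrightarrow>
           w (i + 2) = w i - of_int (as ! i) * (\<alpha> - 1) * w (i + 1)"
    and "\<And>i. i < length as \<Longrightarrow> odd i \<Longrightarrow>
           \<alpha> * w (i + 2) = \<alpha> * w i - of_int (as ! i) * (\<alpha> - 1) * w (i + 1)"
proof -
  let ?n = "length as"
  let ?h = "\<lambda>p :: int poly. poly (map_poly of_int p) \<alpha>"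
  let ?c = "\<lambda>i j. \<alpha> * of_int (seifert_entry as i j) - of_int (seifert_entry as j i)"
  interpret h: comm_ring_hom ?h
    \<comment> \<open>Evaluation at \<open>\<alpha>\<close> is a ring homomorphism, so it commutes
      with the determinant.\<close>
    by unfold_locales (auto simp: hom_distribs)
  define M where "M = mat ?n ?n (\<lambda>(i, j). ?c (i + 1) (j + 1))"
  let ?P = "[:0, 1:] \<cdot>\<^sub>m map_mat (\<lambda>u. [:u:]) (seifert_matrix as)
      - map_mat (\<lambda>u. [:u:]) (transpose_mat (seifert_matrix as))"
  have "M = map_mat ?h ?P"
    by (rule eq_matI) (auto simp: M_def seifert_matrix_def of_int_hom.map_poly_pCons_hom h.hom_minus)
  then have "det M = ?h (det ?P)" by (simp only: h.hom_det)
  then have "det M = 0" using assms by (simp only: seifert_poly_def)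
  moreover have M: "M \<in> carrier_mat ?n ?n" by (simp add: M_def)
  ultimately obtain v where v: "v \<in> carrier_vec ?n" "v \<noteq> 0\<^sub>v ?n" "M *\<^sub>v v = 0\<^sub>v ?n"
    using det_0_iff_vec_prod_zero[OF M] by blast
  \<comment> \<open>Indices become 1-based, and zeros at 0 and \<open>?n + 1\<close> give the first
    and last rows the same three-term form as the others.\<close>
  define w where "w i = (if i \<in> {1..?n} then v $ (i - 1) else 0)" for i
  have row: "?c (i + 1) i * w i + ?c (i + 1) (i + 1) * w (i + 1) + ?c (i + 1) (i + 2) * w (i + 2) = 0"
    if i: "i < ?n" for i
  proof -
    let ?g = "\<lambda>j. ?c (i + 1) j * w j"
    have "(M *\<^sub>v v) $ i = (\<Sum>j = 0..<?n. ?g (Suc j))"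
      using i v(1) by (auto simp: M_def scalar_prod_def w_def intro!: sum.cong)
    also have "\<dots> = (\<Sum>j \<in> {Suc 0..<Suc ?n}. ?g j)"
      by (rule sum.shift_bounds_Suc_ivl[symmetric])
    also have "\<dots> = (\<Sum>j \<in> {0..?n + 1}. ?g j)"
      by (rule sum.mono_neutral_left) (auto simp: w_def)
    \<comment> \<open>Only three terms survive because the matrix is tridiagonal.\<close>
    also have "\<dots> = (\<Sum>j \<in> {i, i + 1, i + 2}. ?g j)"
      using i by (intro sum.mono_neutral_right) (auto simp: seifert_entry_def)
    also have "\<dots> = ?g i + ?g (i + 1) + ?g (i + 2)" by simp
    finally show ?thesis using v(3) i by simp
  qed
  show thesis
  proof (rule that[of w])
    show "w 0 = 0" "w (?n + 1) = 0" by (simp_all add: w_def)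
    obtain j where "j < ?n" "v $ j \<noteq> 0"
      using v(1,2) by (metis carrier_vecD eq_vecI index_zero_vec)
    then show "\<exists>i \<in> {1..?n}. w i \<noteq> 0"
      by (intro bexI[of _ "j + 1"]) (auto simp: w_def)
  next
    fix i assume "i < ?n" "even i"
    then show "w (i + 2) = w i - of_int (as ! i) * (\<alpha> - 1) * w (i + 1)"
      using row[of i] by (simp add: seifert_entry_def algebra_simps)
  next
    fix i assume "i < ?n" "odd i"
    then show "\<alpha> * w (i + 2) = \<alpha> * w i - of_int (as ! i) * (\<alpha> - 1) * w (i + 1)"
      using row[of i] by (simp add: seifert_entry_def algebra_simps)
  qed
qed

lemma seifert_zero_Re_gt:
  assumes signs: "set as \<subseteq> {1, -1}" and no3: "no_three_equal as"
    and zero: "poly (map_poly of_int (seifert_poly (seifert_matrix as))) \<alpha> = (0 :: complex)"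
  shows "Re \<alpha> > -1"
proof (rule ccontr)
  assume "\<not> Re \<alpha> > -1"
  then obtain x where x: "x\<^sup>2 = \<alpha>" "Im x \<ge> 1"
    using sqrt_with_Im_ge_1[of \<alpha>] by auto
  then have x0: "x \<noteq> 0" by auto
  define z where "z = x - 1 / x"
  have z: "Im z > 1" using Im_inverse_neg[of x] x(2) by (simp add: z_def)
  have xz: "x * z = \<alpha> - 1"
    using x(1) x0 by (simp add: z_def field_simps power2_eq_square)
  let ?n = "length as"
  obtain w where w: "w 0 = 0" "w (?n + 1) = 0" "\<exists>i \<in> {1..?n}. w i \<noteq> 0"
    and even: "\<And>i. i < ?n \<Longrightarrow> even i \<Longrightarrow>
           w (i + 2) = w i - of_int (as ! i) * (\<alpha> - 1) * w (i + 1)"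
    and odd: "\<And>i. i < ?n \<Longrightarrow> odd i \<Longrightarrow>
           \<alpha> * w (i + 2) = \<alpha> * w i - of_int (as ! i) * (\<alpha> - 1) * w (i + 1)"
    using seifert_kernel_vector[OF zero] by blast
  \<comment> \<open>With \<open>\<alpha> = x\<^sup>2\<close> and
    \<open>\<alpha> - 1 = x * z\<close>, this scaling merges the even and odd recurrences into
    one.\<close>
  define y where "y i = (if even i then w i / x else w i)" for i
  define a :: "nat \<Rightarrow> complex" where "a i = of_int (as ! (i - 1))" for i
  have "\<forall>i \<le> ?n. y i = 0"
  proof (rule continuant_solution_zero[OF z])
    show "a i \<in> {1, -1}" if "i \<in> {1..?n}" for i
    proof -
      have "as ! (i - 1) \<in> {1, -1}" using that signs by (intro subsetD[OF signs] nth_mem) auto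
      then show ?thesis by (auto simp: a_def)
    qed
    show "a (i + 1) \<noteq> a (i + 2)" if "1 \<le> i" "i + 2 \<le> ?n" "a i = a (i + 1)" for i
      using that no3[unfolded no_three_equal_def, rule_format, of "i - 1"] by (auto simp: a_def)
    show "y 0 = 0" "y (?n + 1) = 0" using w by (auto simp: y_def)
    show "y (i + 2) = y i - a (i + 1) * z * y (i + 1)" if "i < ?n" for i
    proof (cases "even i")
      case True
      then have "x * y (i + 2) = x * (y i - a (i + 1) * z * y (i + 1))"
        using even[OF that] x0 by (simp add: y_def a_def xz[symmetric] algebra_simps)
      then show ?thesis using x0 by simp
    next
      case False
      then have y: "y (i + 2) = w (i + 2)" "y i = w i" "w (i + 1) = x * y (i + 1)"
        using x0 by (simp_all add: y_def)
      have "x\<^sup>2 * y (i + 2) = \<alpha> * w i - a (i + 1) * (\<alpha> - 1) * w (i + 1)"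
        unfolding y(1) x(1) a_def using odd[OF that False] by simp
      also have "\<dots> = x\<^sup>2 * (y i - a (i + 1) * z * y (i + 1))"
        unfolding y(2,3) xz[symmetric] unfolding x(1)[symmetric]
        by (simp add: algebra_simps power2_eq_square)
      finally show ?thesis using x0 by simp
    qed
  qed
  then have "\<forall>i \<le> ?n. w i = 0" using x0 by (auto simp: y_def split: if_splits)
  then show False using w(3) by auto
qed

theorem theorem4:
  fixes m :: nat and k :: "nat \<Rightarrow> nat" and r :: rat and \<alpha> :: complex
  assumes "m \<ge> 1"
    and "\<And>j. j \<in> {1..m} \<Longrightarrow> k j > 0"
    and "r = neg_cf (concat (map (\<lambda>j. replicate (k j) ((-1) ^ (j - 1) * 2)) [1..<m + 1]))"
    and "\<And>j. j \<in> {1..m} \<Longrightarrow> k j \<in> {1, 2}"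
    and "poly (map_poly of_int (two_bridge_alexander r)) \<alpha> = 0"
  shows "Re \<alpha> > -1"
proof -
  define as where "as = concat (map (\<lambda>j. replicate (k j) ((-1 :: int) ^ (j - 1))) [1..<m + 1])"
  have as: "no_three_equal as" "set as \<subseteq> {1, -1}" "as \<noteq> []"
    using sign_blocks[of m k] assms(1,4) unfolding as_def by blast+
  \<comment> \<open>Halving the entries of the given fraction yields its even expansion, whose
    Seifert matrix determines the Alexander polynomial.\<close>
  have "map (\<lambda>a. 2 * a) as
      = concat (map (\<lambda>j. replicate (k j) ((-1) ^ (j - 1) * 2)) [1..<m + 1])"
    by (simp add: as_def map_concat o_def mult.commute del: upt_Suc)
  then have "even_expansion r as"
    using as assms(3) by (auto simp: even_expansion_def)
  then show ?thesis
    using seifert_zero_Re_gt[OF as(2,1)] two_bridge_alexander_eq assms(5) by metis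
qed

end
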